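(* Let $d, L_1,\dots,L_d$ be positive integers and suppose $A\subseteq [L_1]\times\cdots\times[L_d]\subseteq\mathbb{Z}^d$. Then \[ |A+A| \geq 2^d|A| + \prod_{i=1}^d(2L_i-1) - \prod_{i=1}^d 2L_i. \]
   Context: For a positive integer $n$, $[n]:=\{0,1,\dots,n-1\}$. $A+A:=\{a_1+a_2:a_1,a_2\in A\}$. *)

theory Defs
  imports "HOL-Analysis.Finite_Cartesian_Product" "HOL-Library.Set_Algebras"
begin

definition int_interval :: "nat \<Rightarrow> int set" where
  "int_interval n = {0..<int n}"

(* The coordinates are indexed by a finite type 'd,
   so that d = CARD('d) is an arbitrary positive integer. *)
definition int_box :: "('d::finite \<Rightarrow> nat) \<Rightarrow> (int ^ 'd) set" where
  "int_box L = {x. \<forall>i. x $ i \<in> int_interval (L i)}"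

end

theory Submission
  imports Defs
begin

text \<open>
  Compressing \<open>A\<close> along a coordinate axis replaces every line of \<open>A\<close> parallel to that axis by the
  initial segment of the same size. This keeps \<open>A\<close> in the box and preserves \<open>card A\<close>, and since
  \<open>card (S + T) \<ge> card S + card T - 1\<close> in the integers it does not increase \<open>card (A + A)\<close>.
  Compressing along each axis once yields a down-set. For \<open>x\<close> in a down-set and \<open>S\<close> contained in
  the support of \<open>x\<close>, the points \<open>2x - 1\<^sub>S = x + (x - 1\<^sub>S)\<close> lie in the sumset and are distinct, as
  \<open>S\<close> is read off from the parities. Hence \<open>2^d |A| - |A + A|\<close> is at most the sum of
  \<open>2^d - 2^|supp x|\<close> over \<open>A\<close>, which is largest for the whole box, where it factorises.
\<close>

section \<open>Sumsets of finite sets of integers\<close>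

lemma card_set_plus_int_ge:
  fixes S T :: "int set"
  assumes "finite S" "finite T" "S \<noteq> {}" "T \<noteq> {}"
  shows "card S + card T \<le> card (S + T) + 1"
proof -
  \<comment> \<open>Two translates inside \<open>S + T\<close>: the first ends at
    \<open>Max S + Min T\<close>, where the second begins, so they share at most that point.\<close>
  let ?U = "(\<lambda>s. s + Min T) ` S" and ?V = "(\<lambda>t. Max S + t) ` T"
  have "?U \<inter> ?V \<subseteq> {Max S + Min T}"
  proof
    fix z assume "z \<in> ?U \<inter> ?V"
    then obtain s t where "s \<in> S" "t \<in> T" "z = s + Min T" "z = Max S + t" by auto
    moreover have "s \<le> Max S" "Min T \<le> t" using assms \<open>s \<in> S\<close> \<open>t \<in> T\<close> by auto
    ultimately show "z \<in> {Max S + Min T}" by auto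
  qed
  then have "card (?U \<inter> ?V) \<le> 1" by (auto dest: card_mono[rotated])
  moreover have "?U \<union> ?V \<subseteq> S + T"
    using Max_in[OF assms(1,3)] Min_in[OF assms(2,4)] by (auto intro: set_plus_intro)
  then have "card (?U \<union> ?V) \<le> card (S + T)"
    using assms by (intro card_mono finite_set_plus) auto
  moreover have "card ?U = card S" "card ?V = card T"
    by (auto intro!: card_image simp: inj_on_def)
  moreover have "card ?U + card ?V = card (?U \<union> ?V) + card (?U \<inter> ?V)"
    using assms by (intro card_Un_Int) auto
  ultimately show ?thesis by linarith
qed

section \<open>Compression along one coordinate axis\<close>

definition vec_upd :: "'d::finite \<Rightarrow> int \<Rightarrow> int ^ 'd \<Rightarrow> int ^ 'd" where
  "vec_upd i t x = (\<chi> j. if j = i then t else x $ j)"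

text \<open>A line in direction \<open>i\<close>, recorded by the \<open>i\<close>-th coordinates of
  its points in \<open>A\<close>. As \<open>x $ i\<close> is overwritten, any point of the line, in
  \<open>A\<close> or not, may serve as \<open>x\<close>.\<close>

definition fiber :: "'d::finite \<Rightarrow> (int ^ 'd) set \<Rightarrow> int ^ 'd \<Rightarrow> int set" where
  "fiber i A x = {t. vec_upd i t x \<in> A}"

text \<open>An infinite fiber has \<open>card\<close> 0 and would be erased, hence the finiteness
  assumptions in the counting lemmas below.\<close>

definition compress :: "'d::finite \<Rightarrow> (int ^ 'd) set \<Rightarrow> (int ^ 'd) set" where
  "compress i A = {x. x $ i \<in> {0..<int (card (fiber i A x))}}"

definition down_closed :: "'d::finite \<Rightarrow> (int ^ 'd) set \<Rightarrow> bool" where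
  "down_closed i A \<longleftrightarrow> (\<forall>x\<in>A. \<forall>t. 0 \<le> t \<and> t \<le> x $ i \<longrightarrow> vec_upd i t x \<in> A)"

lemma vec_upd_nth [simp]: "vec_upd i t x $ j = (if j = i then t else x $ j)"
  by (simp add: vec_upd_def)

lemma vec_upd_vec_upd [simp]: "vec_upd i t (vec_upd i s x) = vec_upd i t x"
  by (simp add: vec_eq_iff)

lemma vec_upd_self [simp]: "vec_upd i (x $ i) x = x"
  by (simp add: vec_eq_iff)

lemma vec_upd_commute: "i \<noteq> j \<Longrightarrow> vec_upd i s (vec_upd j t x) = vec_upd j t (vec_upd i s x)"
  by (simp add: vec_eq_iff)

lemma fiber_vec_upd [simp]: "fiber i A (vec_upd i t x) = fiber i A x"
  by (simp add: fiber_def)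

lemma finite_fiber [simp]: "finite A \<Longrightarrow> finite (fiber i A x)"
proof (rule finite_subset)
  show "fiber i A x \<subseteq> (\<lambda>y. y $ i) ` A"
    by (force simp: fiber_def)
qed simp

lemma fiber_compress: "fiber i (compress i A) x = {0..<int (card (fiber i A x))}"
  unfolding fiber_def[of i "compress i A"] by (auto simp: compress_def)

text \<open>Each point of \<open>P\<close> represents one line by its point with \<open>i\<close>-th
  coordinate 0. Lines missing \<open>A\<close> are allowed and contribute 0, so two sets can be
  counted over a common \<open>P\<close>.\<close>

lemma card_eq_sum_fibers:
  assumes "finite P" "vec_upd i 0 ` A \<subseteq> P" "\<And>x. x \<in> P \<Longrightarrow> x $ i = 0" "finite A"
  shows "card A = (\<Sum>x\<in>P. card (fiber i A x))"
proof -
  have "bij_betw (\<lambda>x. (vec_upd i 0 x, x $ i)) A (Sigma P (fiber i A))"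
  proof (rule bij_betw_byWitness[where f' = "\<lambda>(x, t). vec_upd i t x"])
    show "\<forall>p\<in>Sigma P (fiber i A). (\<lambda>x. (vec_upd i 0 x, x $ i)) (case p of (x, t) \<Rightarrow> vec_upd i t x) = p"
    proof clarsimp
      fix x t assume "x \<in> P"
      then show "vec_upd i 0 x = x" using vec_upd_self[of i x] assms(3)[of x] by simp
    qed
    show "(\<lambda>x. (vec_upd i 0 x, x $ i)) ` A \<subseteq> Sigma P (fiber i A)"
      using assms(2) by (auto simp: fiber_def)
  qed (auto simp: fiber_def)
  then have "card A = card (Sigma P (fiber i A))" by (rule bij_betw_same_card)
  also have "\<dots> = (\<Sum>x\<in>P. card (fiber i A x))"
    using assms by (intro card_SigmaI) auto
  finally show ?thesis .
qed

lemma card_le_of_fibers: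
  assumes "finite A" "finite B" "\<And>x. card (fiber i A x) \<le> card (fiber i B x)"
  shows "card A \<le> card B"
proof -
  let ?P = "vec_upd i 0 ` (A \<union> B)"
  have "card A = (\<Sum>x\<in>?P. card (fiber i A x))" "card B = (\<Sum>x\<in>?P. card (fiber i B x))"
    using assms by (intro card_eq_sum_fibers; auto)+
  with assms(3) show ?thesis by (simp add: sum_mono)
qed

lemma compress_subset_int_box:
  assumes "A \<subseteq> int_box L"
  shows "compress i A \<subseteq> int_box L"
proof
  fix x assume x: "x \<in> compress i A"
  have "fiber i A x \<subseteq> {0..<int (L i)}"
  proof
    fix t assume "t \<in> fiber i A x"
    then have "vec_upd i t x \<in> int_box L" using assms by (auto simp: fiber_def)
    then have "vec_upd i t x $ i \<in> int_interval (L i)" unfolding int_box_def by blast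
    then show "t \<in> {0..<int (L i)}" by (simp add: int_interval_def)
  qed
  from card_mono[OF _ this] have "x $ i \<in> int_interval (L i)"
    using x by (auto simp: compress_def int_interval_def)
  \<comment> \<open>The line through \<open>x\<close> meets \<open>A\<close>, and a point of
    \<open>A\<close> on it has the same coordinates as \<open>x\<close> away from
    \<open>i\<close>.\<close>
  moreover from x have "fiber i A x \<noteq> {}" by (auto simp: compress_def)
  then obtain t where "vec_upd i t x \<in> int_box L" using assms by (auto simp: fiber_def)
  then have "vec_upd i t x $ j \<in> int_interval (L j)" for j unfolding int_box_def by blast
  then have "x $ j \<in> int_interval (L j)" if "j \<noteq> i" for j
    using that by (metis vec_upd_nth)
  ultimately have "x $ j \<in> int_interval (L j)" for j by (cases "j = i") auto
  then show "x \<in> int_box L" by (simp add: int_box_def)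
qed

lemma card_compress:
  assumes "finite A" "finite (compress i A)"
  shows "card (compress i A) = card A"
  using assms by (intro antisym card_le_of_fibers[where i = i]) (simp_all add: fiber_compress)

text \<open>Fibers of the compressed set are initial segments, so on each line only the largest sum
  needs a bound. The integer estimate gives it for one pair of fibers at a time.\<close>

lemma card_compress_plus_le:
  assumes "finite A" "finite (compress i A)"
  shows "card (compress i A + compress i A) \<le> card (A + A)"
proof (rule card_le_of_fibers[where i = i])
  fix w
  have "fiber i (compress i A + compress i A) w \<subseteq> {0..<int (card (fiber i (A + A) w))}"
  proof
    fix t assume "t \<in> fiber i (compress i A + compress i A) w"
    then obtain x y where xy: "x \<in> compress i A" "y \<in> compress i A" "vec_upd i t w = x + y"
      by (auto simp: fiber_def elim: set_plus_elim)
    have "fiber i A x + fiber i A y \<subseteq> fiber i (A + A) w"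
    proof (clarsimp simp: fiber_def elim!: set_plus_elim)
      fix a b assume ab: "vec_upd i a x \<in> A" "vec_upd i b y \<in> A"
      have "vec_upd i (a + b) w = vec_upd i a x + vec_upd i b y"
        using xy(3) by (auto simp: vec_eq_iff) metis
      with ab show "vec_upd i (a + b) w \<in> A + A" by (simp add: set_plus_intro)
    qed
    then have "card (fiber i A x + fiber i A y) \<le> card (fiber i (A + A) w)"
      using assms by (intro card_mono) (auto intro!: finite_fiber finite_set_plus)
    moreover have "fiber i A x \<noteq> {}" "fiber i A y \<noteq> {}"
      using xy by (auto simp: compress_def)
    then have "card (fiber i A x) + card (fiber i A y) \<le> card (fiber i A x + fiber i A y) + 1"
      using assms by (intro card_set_plus_int_ge) auto
    \<comment> \<open>Each coordinate is at most its fiber size minus 1, so \<open>t\<close> is at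
      most the sum of the two sizes minus 2. This absorbs the loss of 1 in the sumset bound and
      keeps the inequality strict.\<close>
    moreover have "t = x $ i + y $ i"
      using arg_cong[OF xy(3), of "\<lambda>v. v $ i"] by simp
    ultimately show "t \<in> {0..<int (card (fiber i (A + A) w))}"
      using xy(1,2) by (auto simp: compress_def)
  qed
  from card_mono[OF _ this]
  show "card (fiber i (compress i A + compress i A) w) \<le> card (fiber i (A + A) w)" by simp
qed (use assms in \<open>auto intro: finite_set_plus\<close>)

lemma down_closed_compress_self: "down_closed i (compress i A)"
  by (auto simp: down_closed_def compress_def)

text \<open>Lowering coordinate \<open>j\<close> can only enlarge the fiber in direction
  \<open>i\<close>, so the bound on \<open>x $ i\<close> survives. Later compressions thus do not
  undo earlier ones.\<close>

lemma down_closed_compress: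
  assumes "down_closed j A" "finite A" "i \<noteq> j"
  shows "down_closed j (compress i A)"
  unfolding down_closed_def
proof (intro ballI allI impI)
  fix x t assume x: "x \<in> compress i A" and t: "0 \<le> t \<and> t \<le> x $ j"
  have "fiber i A x \<subseteq> fiber i A (vec_upd j t x)"
  proof
    fix s assume "s \<in> fiber i A x"
    then have "vec_upd j t (vec_upd i s x) \<in> A"
      using assms(1,3) t by (simp add: fiber_def down_closed_def)
    then show "s \<in> fiber i A (vec_upd j t x)"
      using assms(3) by (simp add: fiber_def vec_upd_commute)
  qed
  then have "card (fiber i A x) \<le> card (fiber i A (vec_upd j t x))"
    using assms(2) by (intro card_mono) auto
  with x show "vec_upd j t x \<in> compress i A"
    using assms(3) by (auto simp: compress_def)
qed

section \<open>Sums of products over the box\<close>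

lemma int_box_eq_image: "int_box L = vec_lambda ` Pi\<^sub>E UNIV (\<lambda>i. int_interval (L i))"
proof
  show "int_box L \<subseteq> vec_lambda ` Pi\<^sub>E UNIV (\<lambda>i. int_interval (L i))"
  proof
    fix x assume "x \<in> int_box L"
    then have "vec_nth x \<in> Pi\<^sub>E UNIV (\<lambda>i. int_interval (L i))" by (auto simp: int_box_def)
    then show "x \<in> vec_lambda ` Pi\<^sub>E UNIV (\<lambda>i. int_interval (L i))"
      by (metis image_eqI vec_nth_inverse)
  qed
qed (auto simp: int_box_def)

lemma finite_int_box: "finite (int_box L)"
  by (simp add: int_box_eq_image finite_PiE int_interval_def)

lemma sum_prod_int_box:
  fixes f :: "'d::finite \<Rightarrow> int \<Rightarrow> int"
  shows "(\<Sum>x\<in>int_box L. \<Prod>i\<in>UNIV. f i (x $ i)) = (\<Prod>i\<in>UNIV. \<Sum>t\<in>int_interval (L i). f i t)"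
proof -
  have "(\<Sum>x\<in>int_box L. \<Prod>i\<in>UNIV. f i (x $ i)) =
      (\<Sum>g\<in>Pi\<^sub>E UNIV (\<lambda>i. int_interval (L i)). \<Prod>i\<in>UNIV. f i (g i))"
    by (simp add: int_box_eq_image sum.reindex inj_on_def vec_lambda_inject)
  also have "\<dots> = (\<Prod>i\<in>UNIV. \<Sum>t\<in>int_interval (L i). f i t)"
    by (simp add: prod_sum_PiE int_interval_def)
  finally show ?thesis .
qed

section \<open>From arbitrary sets to down-sets\<close>

lemma down_closed_replacement:
  fixes A :: "(int ^ 'd::finite) set"
  assumes "A \<subseteq> int_box L"
  obtains B where "B \<subseteq> int_box L" "card B = card A" "card (B + B) \<le> card (A + A)"
    "\<And>i. down_closed i B"
proof -
  \<comment> \<open>Induction on the set \<open>I\<close> of axes already compressed.\<close>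
  have "\<exists>B \<subseteq> int_box L. card B = card A \<and> card (B + B) \<le> card (A + A) \<and> (\<forall>i\<in>I. down_closed i B)"
    if "finite I" for I :: "'d set"
    using that
  proof (induction I)
    case empty
    then show ?case using assms by auto
  next
    case (insert i I)
    then obtain B where B: "B \<subseteq> int_box L" "card B = card A" "card (B + B) \<le> card (A + A)"
      "\<forall>i\<in>I. down_closed i B" by blast
    have sub: "compress i B \<subseteq> int_box L" using B(1) by (rule compress_subset_int_box)
    have fin: "finite B" "finite (compress i B)"
      using B(1) sub finite_int_box finite_subset by blast+
    have "down_closed j (compress i B)" if "j \<in> insert i I" for j
      using that B(4) fin(1) by (cases "j = i") (simp_all add: down_closed_compress_self down_closed_compress)
    with sub card_compress[OF fin] card_compress_plus_le[OF fin] B(2,3)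
    show ?case by (intro exI[of _ "compress i B"]) auto
  qed
  from this[of UNIV] that show ?thesis by auto
qed

lemma down_closed_mem:
  fixes B :: "(int ^ 'd::finite) set"
  assumes "\<And>i. down_closed i B" "x \<in> B" "\<And>i. 0 \<le> y $ i" "\<And>i. y $ i \<le> x $ i"
  shows "y \<in> B"
proof -
  \<comment> \<open>Move from \<open>x\<close> down to \<open>y\<close> one coordinate at a time;
    \<open>I\<close> holds the coordinates already lowered.\<close>
  have "(\<chi> i. if i \<in> I then y $ i else x $ i) \<in> B" if "finite I" for I :: "'d set"
    using that
  proof (induction I)
    case (insert i I)
    let ?z = "\<chi> i. if i \<in> I then y $ i else x $ i"
    have "vec_upd i (y $ i) ?z \<in> B"
      using assms(1)[of i] assms(3,4)[of i] insert unfolding down_closed_def by fastforce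
    moreover have "vec_upd i (y $ i) ?z = (\<chi> j. if j \<in> insert i I then y $ j else x $ j)"
      by (simp add: vec_eq_iff)
    ultimately show ?case by simp
  qed (use assms(2) in simp)
  from this[of UNIV] show ?thesis by simp
qed

section \<open>Counting sums in a down-set\<close>

lemma card_plus_down_set_ge:
  fixes B :: "(int ^ 'd::finite) set"
  assumes "finite B" "\<And>i. down_closed i B" "\<And>x i. x \<in> B \<Longrightarrow> 0 \<le> x $ i"
  shows "(\<Sum>x\<in>B. 2 ^ card {i. x $ i \<noteq> 0}) \<le> card (B + B)"
proof -
  let ?D = "Sigma B (\<lambda>x. Pow {i. x $ i \<noteq> 0})"
  let ?e = "\<lambda>S :: 'd set. (\<chi> i. if i \<in> S then 1 else 0) :: int ^ 'd"
  let ?g = "\<lambda>(x, S). x + (x - ?e S)"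
  have "inj_on ?g ?D"
  proof (rule inj_onI, clarify)
    fix x y :: "int ^ 'd" and S T
    assume "x + (x - ?e S) = y + (y - ?e T)"
    then have "(x + (x - ?e S)) $ i = (y + (y - ?e T)) $ i" for i by (rule arg_cong)
    then have eq: "2 * x $ i - (if i \<in> S then 1 else 0) = 2 * y $ i - (if i \<in> T then 1 else 0)" for i
      by (simp only: vector_add_component vector_minus_component vec_lambda_beta mult_2 add_diff_eq)
    \<comment> \<open>Coordinate \<open>i\<close> of the sum is odd exactly when \<open>i\<close>
      lies in the chosen subset.\<close>
    have "i \<in> S \<longleftrightarrow> i \<in> T" for i
      using eq[of i] by (cases "i \<in> S"; cases "i \<in> T"; simp; presburger)
    then have "S = T" by blast
    moreover have "x $ i = y $ i" for i using eq[of i] \<open>S = T\<close> by simp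
    ultimately show "x = y \<and> S = T" by (simp add: vec_eq_iff)
  qed
  moreover have "?g ` ?D \<subseteq> B + B"
  proof clarify
    fix x S assume x: "x \<in> B" "S \<subseteq> {i. x $ i \<noteq> 0}"
    have "x - ?e S \<in> B"
    proof (rule down_closed_mem[OF assms(2) x(1)])
      \<comment> \<open>On \<open>S\<close> the coordinates of \<open>x\<close> are nonnegative and
        nonzero integers, hence at least 1.\<close>
      show "0 \<le> (x - ?e S) $ i" for i
        using assms(3)[OF x(1), of i] x(2) by fastforce
    qed simp
    with x(1) show "x + (x - ?e S) \<in> B + B" by (rule set_plus_intro)
  qed
  ultimately have "card ?D \<le> card (B + B)"
    using assms(1) by (intro card_inj_on_le finite_set_plus)
  then show ?thesis using assms(1) by (simp add: card_Pow)
qed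

theorem theorem2p1:
  fixes L :: "'d::finite \<Rightarrow> nat" and A :: "(int ^ 'd) set"
  assumes "\<And>i. 0 < L i"
    and "A \<subseteq> int_box L"
  shows "int (card (A + A)) \<ge>
    2 ^ CARD('d) * int (card A) + (\<Prod>i\<in>UNIV. 2 * int (L i) - 1) - (\<Prod>i\<in>UNIV. 2 * int (L i))"
proof -
  obtain B where B: "B \<subseteq> int_box L" "card B = card A" "card (B + B) \<le> card (A + A)"
    "\<And>i. down_closed i B"
    using down_closed_replacement[OF assms(2)] by blast
  let ?w = "\<lambda>x :: int ^ 'd. 2 ^ card {i. x $ i \<noteq> 0} :: int"
  have "finite B" using B(1) finite_int_box by (rule finite_subset)
  then have "(\<Sum>x\<in>B. 2 ^ card {i. x $ i \<noteq> 0}) \<le> card (B + B)"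
    using B(1,4) by (intro card_plus_down_set_ge) (auto simp: int_box_def int_interval_def)
  then have "int (\<Sum>x\<in>B. 2 ^ card {i. x $ i \<noteq> 0}) \<le> int (card (B + B))" by (rule of_nat_mono)
  then have lower: "(\<Sum>x\<in>B. ?w x) \<le> int (card (A + A))"
    using B(3) by simp
  \<comment> \<open>A support has at most \<open>CARD('d)\<close> elements, so the summands are
    nonnegative and enlarging \<open>B\<close> to the box can only increase the sum.\<close>
  have "(\<Sum>x\<in>B. 2 ^ CARD('d) - ?w x) \<le> (\<Sum>x\<in>int_box L. 2 ^ CARD('d) - ?w x)"
    using B(1) by (intro sum_mono2 finite_int_box) (auto intro!: power_increasing card_mono)
  moreover have "(\<Sum>x\<in>int_box L. 2 ^ CARD('d) :: int) = (\<Prod>i\<in>UNIV. 2 * int (L i))"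
    using sum_prod_int_box[of "\<lambda>_ _. 2" L] by (simp add: int_interval_def mult.commute)
  moreover have "(\<Sum>x\<in>int_box L. ?w x) = (\<Prod>i\<in>UNIV. 2 * int (L i) - 1)"
  proof -
    \<comment> \<open>The weight splits over coordinates. Per axis, 0 contributes 1 and each of the
      other \<open>n - 1\<close> values contributes 2, giving \<open>2 * n - 1\<close>.\<close>
    have "?w x = (\<Prod>i\<in>UNIV. if x $ i \<noteq> 0 then 2 else 1)" for x :: "int ^ 'd"
      by (simp add: prod.If_cases)
    moreover have "(\<Sum>t\<in>int_interval n. if t \<noteq> 0 then 2 else 1 :: int) = 2 * int n - 1"
      if "0 < n" for n
    proof -
      have "int_interval n = insert 0 {1..<int n}" using that by (auto simp: int_interval_def)
      then have "(\<Sum>t\<in>int_interval n. if t \<noteq> 0 then 2 else 1 :: int) =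
          1 + (\<Sum>t\<in>{1..<int n}. 2)" by simp
      then show ?thesis using that by simp
    qed
    ultimately show ?thesis
      using sum_prod_int_box[of "\<lambda>_ t. if t \<noteq> 0 then 2 else 1" L] assms(1) by simp
  qed
  ultimately show ?thesis
    using lower B(2) by (simp add: sum_subtractf mult.commute)
qed

end
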